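(* Let $(X,\|\cdot\|)$ be a positive definite balancedly weighted vector space, and let $\Upsilon(X,\|\cdot\|)=(\nu,\mu)$. Assume $\nu\ne-\infty$ and $\mu\ne\infty$. Then the infimum and the supremum defining $\nu$ and $\mu$ are attained: $$\nu=\min\{\kappa\in\mathbb{R}\mid (X,\|\cdot\|)\text{ has the angle }\angle_\kappa\},\qquad \mu=\max\{\kappa\in\mathbb{R}\mid (X,\|\cdot\|)\text{ has the angle }\angle_\kappa\}.$$
   Context: A balancedly weighted vector space ($\mathsf{BW}$ space) $(X,\|\cdot\|)$ is a real topological vector space $X$ with a continuous map $\|\cdot\|:X\to[0,\infty)$ (the weight) such that $\|r\cdot\vec x\|=|r|\cdot\|\vec x\|$ for all $r\in\mathbb{R}$, $\vec x\in X$. The triangle inequality is not assumed. It is positive definite if $\|\vec x\|=0$ holds only for $\vec x=\vec 0$. Let $(X,\|\cdot\|)$ be a positive definite $\mathsf{BW}$ space and $\varrho\in\mathbb{R}$. For $\vec x,\vec y\in X\setminus\{\vec 0\}$ put $\mathbf{s}=\left\|\frac{\vec x}{\|\vec x\|}+\frac{\vec y}{\|\vec y\|}\right\|$, $\mathbf{d}=\left\|\frac{\vec x}{\|\vec x\|}-\frac{\vec y}{\|\vec y\|}\right\|$, $\mathbf{\Sigma}=\mathbf{s}^2+\mathbf{d}^2$ (which is $>0$), $\mathbf{\Delta}=\mathbf{s}^2-\mathbf{d}^2$, and $\langle\vec x\,|\,\vec y\rangle_\varrho=\|\vec x\|\cdot\|\vec y\|\cdot\frac14\mathbf{\Delta}\cdot\left(\frac14\mathbf{\Sigma}\right)^{\varrho}$;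 put $\langle\vec x\,|\,\vec y\rangle_\varrho=0$ if $\vec x=\vec 0$ or $\vec y=\vec 0$. The space "has the angle $\angle_\varrho$" if $|\langle\vec x\,|\,\vec y\rangle_\varrho|\le\|\vec x\|\cdot\|\vec y\|$ for all $\vec x,\vec y\in X$. $\Upsilon(X,\|\cdot\|):=(\nu,\mu)$, where $\nu:=\inf\{\kappa\in\mathbb{R}\mid(X,\|\cdot\|)\text{ has the angle }\angle_\kappa\}$ and $\mu:=\sup\{\kappa\in\mathbb{R}\mid(X,\|\cdot\|)\text{ has the angle }\angle_\kappa\}$ in the extended reals; one has $\nu\in[-\infty,-1]$ and $\mu\in[-1,+\infty]$. *)

theory Defs
  imports "HOL-Analysis.Analysis"
begin

(* The library has no class of real topological vector spaces; joint continuity of scalar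
   multiplication is stated in the same style as tendsto_add_Pair for addition.  No
   separation axiom is assumed. *)
class real_topological_vector = topological_ab_group_add + real_vector +
  assumes tendsto_scaleR_Pair:
    "LIM p (nhds a \<times>\<^sub>F nhds x). fst p *\<^sub>R snd p :> nhds (a *\<^sub>R x)"

instance real_normed_vector \<subseteq> real_topological_vector
proof
  fix a :: real and x :: 'a
  show "LIM p (nhds a \<times>\<^sub>F nhds x). fst p *\<^sub>R snd p :> nhds (a *\<^sub>R x)"
    by (intro tendsto_scaleR filterlim_fst filterlim_snd)
qed

locale bw_space =
  fixes weight :: "'a::real_topological_vector \<Rightarrow> real"
  assumes continuous_weight: "continuous_on UNIV weight"
    and weight_nonneg: "0 \<le> weight x"
    and weight_scaleR: "weight (r *\<^sub>R x) = \<bar>r\<bar> * weight x"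

locale positive_definite_bw_space = bw_space +
  assumes weight_eq_0D: "weight x = 0 \<Longrightarrow> x = 0"

definition unit_sum :: "('a::real_vector \<Rightarrow> real) \<Rightarrow> 'a \<Rightarrow> 'a \<Rightarrow> real" where
  "unit_sum weight x y = weight (x /\<^sub>R weight x + y /\<^sub>R weight y)"

definition unit_diff :: "('a::real_vector \<Rightarrow> real) \<Rightarrow> 'a \<Rightarrow> 'a \<Rightarrow> real" where
  "unit_diff weight x y = weight (x /\<^sub>R weight x - y /\<^sub>R weight y)"

definition Sigma_bw :: "('a::real_vector \<Rightarrow> real) \<Rightarrow> 'a \<Rightarrow> 'a \<Rightarrow> real" where
  "Sigma_bw weight x y = (unit_sum weight x y)\<^sup>2 + (unit_diff weight x y)\<^sup>2"

definition Delta_bw :: "('a::real_vector \<Rightarrow> real) \<Rightarrow> 'a \<Rightarrow> 'a \<Rightarrow> real" where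
  "Delta_bw weight x y = (unit_sum weight x y)\<^sup>2 - (unit_diff weight x y)\<^sup>2"

(* For nonzero x, y in a positive definite space the base of powr is positive. *)
definition bw_product :: "('a::real_vector \<Rightarrow> real) \<Rightarrow> real \<Rightarrow> 'a \<Rightarrow> 'a \<Rightarrow> real" where
  "bw_product weight \<rho> x y =
     (if x = 0 \<or> y = 0 then 0
      else weight x * weight y * (1/4 * Delta_bw weight x y) * (1/4 * Sigma_bw weight x y) powr \<rho>)"

definition has_angle :: "('a::real_vector \<Rightarrow> real) \<Rightarrow> real \<Rightarrow> bool" where
  "has_angle weight \<rho> \<longleftrightarrow> (\<forall>x y. \<bar>bw_product weight \<rho> x y\<bar> \<le> weight x * weight y)"

definition Upsilon :: "('a::real_vector \<Rightarrow> real) \<Rightarrow> ereal \<times> ereal" where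
  "Upsilon weight =
     (Inf (ereal ` {\<kappa>. has_angle weight \<kappa>}), Sup (ereal ` {\<kappa>. has_angle weight \<kappa>}))"

end

theory Submission
  imports Defs
begin

text \<open>
  A closed set of reals that is nonempty and bounded on one side contains its extremum on that
  side, so the theorem asks for two properties of the set of exponents \<open>\<kappa>\<close> whose angle exists.
  It is closed: for fixed \<open>x\<close> and \<open>y\<close> the product depends on \<open>\<kappa>\<close> only through the factor
  \<open>(\<Sigma>/4) powr \<kappa>\<close>, which is continuous in \<open>\<kappa>\<close>, and so each pair \<open>(x, y)\<close> contributes a closed
  condition on \<open>\<kappa>\<close> (\<open>closed_angle_exponents\<close>). It is nonempty: for \<open>\<kappa> = -1\<close> the normalised
  product is \<open>\<Delta>/\<Sigma>\<close>, a difference of two squares divided by their sum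
  (\<open>has_angle_minus_one\<close>). Finiteness of \<open>\<nu>\<close> and \<open>\<mu>\<close> supplies the bounds.
\<close>

text \<open>For \<open>b = 0\<close> the function is constant, because \<open>0 powr k = 0\<close> even at \<open>k = 0\<close>.\<close>

lemma continuous_on_powr_exponent: "continuous_on A (\<lambda>k. b powr k)" for b :: real
  by (cases "b = 0") (auto intro!: continuous_intros)

lemma continuous_on_bw_product_exponent:
  "continuous_on A (\<lambda>k. bw_product weight k x y)"
  unfolding bw_product_def
  by (cases "x = 0 \<or> y = 0")
     (auto intro!: continuous_intros continuous_on_powr_exponent)

lemma closed_angle_exponents: "closed {k. has_angle weight k}"
  unfolding has_angle_def
  by (intro closed_Collect_all closed_Collect_le continuous_intros
        continuous_on_bw_product_exponent)

lemma abs_diff_over_sum_le_1: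
  fixes a b :: real
  assumes "0 \<le> a" "0 \<le> b"
  shows "\<bar>(a - b) / (a + b)\<bar> \<le> 1"
  using assms by (cases "a + b = 0") (auto simp: abs_divide divide_le_eq)

text \<open>Raised to the power \<open>-1\<close>, the factor \<open>\<Sigma>/4\<close> cancels the quarter of \<open>\<Delta>/4\<close> and leaves
  \<open>\<Delta>/\<Sigma>\<close>, which lies between \<open>-1\<close> and \<open>1\<close>.\<close>

lemma (in bw_space) has_angle_minus_one: "has_angle weight (- 1)"
  unfolding has_angle_def
proof (intro allI)
  fix x y
  let ?s = "(unit_sum weight x y)\<^sup>2" and ?d = "(unit_diff weight x y)\<^sup>2"
  let ?w = "weight x * weight y"
  have w: "0 \<le> ?w" by (simp add: weight_nonneg)
  show "\<bar>bw_product weight (- 1) x y\<bar> \<le> ?w"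
  proof (cases "x = 0 \<or> y = 0")
    case True
    then show ?thesis using w by (auto simp: bw_product_def)
  next
    case False
    then have "bw_product weight (- 1) x y
        = ?w * (1/4 * Delta_bw weight x y * (1/4 * Sigma_bw weight x y) powr (- 1))"
      by (simp only: bw_product_def if_False mult.assoc)
    also have "1/4 * Delta_bw weight x y * (1/4 * Sigma_bw weight x y) powr (- 1)
        = Delta_bw weight x y / Sigma_bw weight x y"
      by (simp add: powr_minus_divide Sigma_bw_def)
    finally have "bw_product weight (- 1) x y = ?w * ((?s - ?d) / (?s + ?d))"
      by (simp only: Delta_bw_def Sigma_bw_def)
    then have "\<bar>bw_product weight (- 1) x y\<bar> = ?w * \<bar>(?s - ?d) / (?s + ?d)\<bar>"
      by (simp only: abs_mult abs_of_nonneg weight_nonneg)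
    also have "\<dots> \<le> ?w"
      using mult_left_mono[OF abs_diff_over_sum_le_1 w] by simp
    finally show ?thesis .
  qed
qed

lemma closed_ereal_Inf_attained:
  fixes S :: "real set"
  assumes "closed S" "S \<noteq> {}" and fin: "Inf (ereal ` S) \<noteq> -\<infinity>"
  shows "\<exists>m\<in>S. Inf (ereal ` S) = ereal m \<and> (\<forall>k\<in>S. m \<le> k)"
proof -
  have "Inf (ereal ` S) \<noteq> \<infinity>"
    using \<open>S \<noteq> {}\<close> by (auto simp: Inf_eq_PInfty)
  then obtain r where r: "Inf (ereal ` S) = ereal r"
    using fin by (cases "Inf (ereal ` S)") auto
  have bdd: "bdd_below S"
    by (rule bdd_belowI[of _ r]) (metis r Inf_lower imageI ereal_less_eq(3))
  have mem: "Inf S \<in> S"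
    using closed_contains_Inf[OF \<open>S \<noteq> {}\<close> bdd \<open>closed S\<close>] .
  have min: "Inf S \<le> k" if "k \<in> S" for k
    using that bdd by (rule cInf_lower)
  have "Inf (ereal ` S) = ereal (Inf S)"
    using mem min by (intro Inf_eqI) auto
  with mem min show ?thesis by blast
qed

lemma closed_ereal_Sup_attained:
  fixes S :: "real set"
  assumes "closed S" "S \<noteq> {}" and fin: "Sup (ereal ` S) \<noteq> \<infinity>"
  shows "\<exists>M\<in>S. Sup (ereal ` S) = ereal M \<and> (\<forall>k\<in>S. k \<le> M)"
proof -
  have "Sup (ereal ` S) \<noteq> -\<infinity>"
    using \<open>S \<noteq> {}\<close> by (auto simp: Sup_eq_MInfty)
  then obtain r where r: "Sup (ereal ` S) = ereal r"
    using fin by (cases "Sup (ereal ` S)") auto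
  have bdd: "bdd_above S"
    by (rule bdd_aboveI[of _ r]) (metis r Sup_upper imageI ereal_less_eq(3))
  have mem: "Sup S \<in> S"
    using closed_contains_Sup[OF \<open>S \<noteq> {}\<close> bdd \<open>closed S\<close>] .
  have max: "k \<le> Sup S" if "k \<in> S" for k
    using that bdd by (rule cSup_upper)
  have "Sup (ereal ` S) = ereal (Sup S)"
    using mem max by (intro Sup_eqI) auto
  with mem max show ?thesis by blast
qed

theorem proposition6:
  fixes weight :: "'a::real_topological_vector \<Rightarrow> real" and \<nu> \<mu> :: ereal
  assumes "positive_definite_bw_space weight"
    and "Upsilon weight = (\<nu>, \<mu>)"
    and "\<nu> \<noteq> -\<infinity>" and "\<mu> \<noteq> \<infinity>"
  shows "(\<exists>m\<in>{\<kappa>. has_angle weight \<kappa>}. \<nu> = ereal m \<and> (\<forall>\<kappa>\<in>{\<kappa>. has_angle weight \<kappa>}. m \<le> \<kappa>)) \<and>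
         (\<exists>M\<in>{\<kappa>. has_angle weight \<kappa>}. \<mu> = ereal M \<and> (\<forall>\<kappa>\<in>{\<kappa>. has_angle weight \<kappa>}. \<kappa> \<le> M))"
proof -
  let ?S = "{\<kappa>. has_angle weight \<kappa>}"
  interpret positive_definite_bw_space weight by fact
  have ne: "?S \<noteq> {}"
    using has_angle_minus_one by blast
  have \<nu>: "\<nu> = Inf (ereal ` ?S)" and \<mu>: "\<mu> = Sup (ereal ` ?S)"
    using assms(2) by (simp_all add: Upsilon_def)
  show ?thesis
    using closed_ereal_Inf_attained[OF closed_angle_exponents ne]
      closed_ereal_Sup_attained[OF closed_angle_exponents ne] assms(3,4)
    unfolding \<nu> \<mu> by (intro conjI)
qed

end
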